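(* Assume all gaps of $J^0$ are open, i.e. $\lambda_j^-<\lambda_j^+$ for $j=1,\dots,q-1$. Suppose that $(u,v)\in\mathfrak X_\nu$, $\nu\in\{2p-1,2p\}$, and that the polynomial $F=\varphi_qf_0^+f_0^-$ has only simple zeros. Then the Jost function $f_0^+$ is uniquely determined by the polynomials $F$ and $\varphi_0^+$. (That is, for the fixed background $J^0$ and fixed $\nu$, if two elements of $\mathfrak X_\nu$ have the same $F$, with only simple zeros, and the same $\varphi_0^+$, then they have the same Jost function $f_0^+$.)
   Context: Operators. $\mathbb N=\{1,2,\dots\}$, $\ell^2=\ell^2(\mathbb N)$, $q\ge2$, $p\ge1$ integers. $a_n^0>0$, $b_n^0\in\mathbb R$ are fixed $q$-periodic sequences with $\prod_{j=1}^q a_j^0=1$ and $a_0^0=a_q^0$. The operator $J^0$ on $\ell^2$ is $(J^0y)_n=a_{n-1}^0y_{n-1}+a_n^0y_{n+1}+b_n^0y_n$, $n\ge1$, with $y_0=0$. For $(u,v)=(u_n,v_n)_{n=1}^p\in\mathbb R^{2p}$ put $a_n=a_n^0+u_n$, $b_n=b_n^0+v_n$ for $1\le n\le p$, $a_n=a_n^0$, $b_n=b_n^0$ for $n\ge p+1$, $a_0=a_0^0$; $J=J^0+V$ is $(Jy)_n=a_{n-1}y_{n-1}+a_ny_{n+1}+b_ny_n$, $n\ge1$, $y_0=0$. Classes: $\mathfrak X_{2p}=\{(u,v)\in\mathbb R^{2p}: a_n^0+u_n>0\ (1\le n\le p),\ u_p\ne0\}$ and $\mathfrak X_{2p-1}=\{(u,v)\in\mathbb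 R^{2p}: a_n^0+u_n>0\ (1\le n\le p),\ u_p=0,\ v_p\neq0\}$. Periodic objects. $\varphi_n(\lambda),\vartheta_n(\lambda)$ are the solutions of $a_{n-1}^0y_{n-1}+a_n^0y_{n+1}+b_n^0y_n=\lambda y_n$ with $\vartheta_0=\varphi_1=1$, $\vartheta_1=\varphi_0=0$; $\Delta=\frac12(\varphi_{q+1}+\vartheta_q)$, $\phi=\frac12(\varphi_{q+1}-\vartheta_q)$. The $2q$ zeros of $\Delta^2-1$ (with multiplicity) are $\lambda_0^+<\lambda_1^-\le\lambda_1^+<\dots<\lambda_{q-1}^-\le\lambda_{q-1}^+<\lambda_q^-$. Bands: $\sigma_j=[\lambda_{j-1}^+,\lambda_j^-]$, $\sigma_{\rm ac}(J^0)=\bigcup_{j=1}^q\sigma_j$. Gaps: $\gamma_j=(\lambda_j^-,\lambda_j^+)$, $1\le j\le q-1$. Riemann surface. $\Lambda$ is the two-sheeted Riemann surface of $\sqrt{1-\Delta^2}$, obtained by gluing crosswise two copies $\Lambda_1$ (first, physical sheet, identified with $\mathbb C\setminus\sigma_{\rm ac}(J^0)$) and $\Lambda_2$ along the bands. $\Omega=\sqrt{1-\Delta^2}$ on $\Lambda$ is the branch with $\Omega<0$ on (the upper rim of) $(\lambda_{q-1}^+,\lambda_q^-)\subset\Lambda_1$, i.e. $|\Delta+i\Omega|<1$ on $\Lambda_1$. $m_\pm=\dfrac{\phi\pm i\Omega}{\varphi_q}$, meromorphic on $\Lambda$; $\psi_n^\pm=\vartheta_n+m_\pm\varphi_n$.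 Jost solutions. $\vartheta_n^+,\varphi_n^+,f_n^\pm$ ($n\ge0$) are the solutions of $a_{n-1}y_{n-1}+a_ny_{n+1}+b_ny_n=\lambda y_n$, $n\ge1$, with $\vartheta_n^+=\vartheta_n$, $\varphi_n^+=\varphi_n$, $f_n^\pm=\psi_n^\pm$ for $n\ge p+1$; $\vartheta_n^+,\varphi_n^+$ are polynomials in $\lambda$ and $f_n^\pm=\vartheta_n^++m_\pm\varphi_n^+$. $F(\lambda)=\varphi_q(\lambda)f_0^+(\lambda)f_0^-(\lambda)$, $\lambda\in\Lambda_1$, is a polynomial. *)

theory Defs
  imports "HOL-Analysis.Analysis" "HOL-Computational_Algebra.Polynomial"
begin

section \<open>Jacobi recurrences\<close>

definition periodic_background :: "nat \<Rightarrow> (nat \<Rightarrow> real) \<Rightarrow> (nat \<Rightarrow> real) \<Rightarrow> bool" where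
  "periodic_background q a0 b0 \<longleftrightarrow>
     (\<forall>n. a0 n > 0) \<and> (\<forall>n. a0 (n + q) = a0 n) \<and> (\<forall>n\<ge>1. b0 (n + q) = b0 n) \<and>
     (\<Prod>j=1..q. a0 j) = 1"

text \<open>Solutions that depend polynomially on the spectral parameter \<open>\<lambda>\<close> are treated as sequences
  of polynomials; the parameter itself is the polynomial \<open>[:0, 1:]\<close>.  The coefficient field is left
  generic, because the zeros of \<open>\<Delta>\<^sup>2 - 1\<close> have to be ordered (so \<open>\<Delta>\<close> is read as a real polynomial)
  whereas functions on the Riemann surface need complex polynomials.\<close>

definition jacobi_solution ::
    "(nat \<Rightarrow> real) \<Rightarrow> (nat \<Rightarrow> real) \<Rightarrow> (nat \<Rightarrow> 'a::real_field poly) \<Rightarrow> bool" where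
  "jacobi_solution a b y \<longleftrightarrow>
     (\<forall>n\<ge>1. smult (of_real (a (n - 1))) (y (n - 1)) + smult (of_real (a n)) (y (n + 1))
             + smult (of_real (b n)) (y n) = [:0, 1:] * y n)"

fun forward_solution ::
    "(nat \<Rightarrow> real) \<Rightarrow> (nat \<Rightarrow> real) \<Rightarrow> 'a::real_field poly \<Rightarrow> 'a poly \<Rightarrow> nat \<Rightarrow> 'a poly" where
  "forward_solution a b y0 y1 0 = y0"
| "forward_solution a b y0 y1 (Suc 0) = y1"
| "forward_solution a b y0 y1 (Suc (Suc n)) =
     smult (of_real (1 / a (Suc n)))
       ([:- of_real (b (Suc n)), 1:] * forward_solution a b y0 y1 (Suc n)
        - smult (of_real (a n)) (forward_solution a b y0 y1 n))"

lemma jacobi_solution_forward: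
  assumes "\<And>n. a n \<noteq> 0"
  shows "jacobi_solution a b (forward_solution a b y0 y1)"
  unfolding jacobi_solution_def
proof (intro allI impI)
  fix n :: nat
  assume "n \<ge> 1"
  then obtain m where "n = Suc m" by (cases n) auto
  then show "smult (of_real (a (n - 1))) (forward_solution a b y0 y1 (n - 1))
      + smult (of_real (a n)) (forward_solution a b y0 y1 (n + 1))
      + smult (of_real (b n)) (forward_solution a b y0 y1 n) = [:0, 1:] * forward_solution a b y0 y1 n"
    using assms[of n] by (simp flip: of_real_mult)
qed

definition theta :: "(nat \<Rightarrow> real) \<Rightarrow> (nat \<Rightarrow> real) \<Rightarrow> nat \<Rightarrow> 'a::real_field poly" where
  "theta a0 b0 = forward_solution a0 b0 1 0"

definition phi :: "(nat \<Rightarrow> real) \<Rightarrow> (nat \<Rightarrow> real) \<Rightarrow> nat \<Rightarrow> 'a::real_field poly" where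
  "phi a0 b0 = forward_solution a0 b0 0 1"

definition Delta :: "nat \<Rightarrow> (nat \<Rightarrow> real) \<Rightarrow> (nat \<Rightarrow> real) \<Rightarrow> 'a::real_field poly" where
  "Delta q a0 b0 = smult (1 / 2) (phi a0 b0 (q + 1) + theta a0 b0 q)"

definition anti_Delta :: "nat \<Rightarrow> (nat \<Rightarrow> real) \<Rightarrow> (nat \<Rightarrow> real) \<Rightarrow> 'a::real_field poly" where
  "anti_Delta q a0 b0 = smult (1 / 2) (phi a0 b0 (q + 1) - theta a0 b0 q)"

section \<open>Bands and gaps\<close>

text \<open>All \<open>2q\<close> zeros of \<open>\<Delta>\<^sup>2 - 1\<close> are real.  Listed increasingly with multiplicity they are
  \<open>\<lambda>\<^sub>0\<^sup>+, \<lambda>\<^sub>1\<^sup>-, \<lambda>\<^sub>1\<^sup>+, \<dots>, \<lambda>\<^sub>q\<^sub>-\<^sub>1\<^sup>-, \<lambda>\<^sub>q\<^sub>-\<^sub>1\<^sup>+, \<lambda>\<^sub>q\<^sup>-\<close>.\<close>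

definition band_edges :: "nat \<Rightarrow> (nat \<Rightarrow> real) \<Rightarrow> (nat \<Rightarrow> real) \<Rightarrow> real list" where
  "band_edges q a0 b0 = sorted_list_of_multiset (proots ((Delta q a0 b0)\<^sup>2 - 1))"

definition lambda_plus :: "nat \<Rightarrow> (nat \<Rightarrow> real) \<Rightarrow> (nat \<Rightarrow> real) \<Rightarrow> nat \<Rightarrow> real" where
  "lambda_plus q a0 b0 j = band_edges q a0 b0 ! (2 * j)"

definition lambda_minus :: "nat \<Rightarrow> (nat \<Rightarrow> real) \<Rightarrow> (nat \<Rightarrow> real) \<Rightarrow> nat \<Rightarrow> real" where
  "lambda_minus q a0 b0 j = band_edges q a0 b0 ! (2 * j - 1)"

definition all_gaps_open :: "nat \<Rightarrow> (nat \<Rightarrow> real) \<Rightarrow> (nat \<Rightarrow> real) \<Rightarrow> bool" where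
  "all_gaps_open q a0 b0 \<longleftrightarrow> (\<forall>j\<in>{1..q-1}. lambda_minus q a0 b0 j < lambda_plus q a0 b0 j)"

definition ac_spectrum :: "nat \<Rightarrow> (nat \<Rightarrow> real) \<Rightarrow> (nat \<Rightarrow> real) \<Rightarrow> real set" where
  "ac_spectrum q a0 b0 = (\<Union>j\<in>{1..q}. {lambda_plus q a0 b0 (j - 1)..lambda_minus q a0 b0 j})"

section \<open>The Riemann surface\<close>

text \<open>A point of the surface of \<open>\<surd>(1 - \<Delta>\<^sup>2)\<close> is encoded as the pair \<open>(\<lambda>, \<Omega>)\<close> of its projection and
  the value of \<open>\<Omega>\<close> there.  When all gaps are open, the zeros of \<open>1 - \<Delta>\<^sup>2\<close> are simple and this
  affine curve is smooth, with its branch points exactly at the band edges; it is then the result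
  of gluing the two sheets crosswise along the bands.  (With a closed gap it would have a node.)
  Off the bands the two values of \<open>\<Delta> + i\<Omega>\<close> are reciprocal with moduli different from 1, and
  the first sheet carries the value of modulus less than 1.\<close>

type_synonym surface_point = "complex \<times> complex"

abbreviation base :: "surface_point \<Rightarrow> complex" where "base \<equiv> fst"

abbreviation Omega :: "surface_point \<Rightarrow> complex" where "Omega \<equiv> snd"

definition Lambda_surface :: "nat \<Rightarrow> (nat \<Rightarrow> real) \<Rightarrow> (nat \<Rightarrow> real) \<Rightarrow> surface_point set" where
  "Lambda_surface q a0 b0 = {P. (Omega P)\<^sup>2 = 1 - (poly (Delta q a0 b0) (base P))\<^sup>2}"

definition first_sheet :: "nat \<Rightarrow> (nat \<Rightarrow> real) \<Rightarrow> (nat \<Rightarrow> real) \<Rightarrow> surface_point set" where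
  "first_sheet q a0 b0 =
     {P \<in> Lambda_surface q a0 b0. base P \<notin> complex_of_real ` ac_spectrum q a0 b0 \<and>
        cmod (poly (Delta q a0 b0) (base P) + \<i> * Omega P) < 1}"

text \<open>Functions with the denominator \<open>\<phi>\<^sub>q\<close> are meant as meromorphic functions on the surface, i.e.
  their values are significant only at the points selected by the following definition.  They are
  the complement of a finite set, so two of these functions agree as meromorphic functions iff they
  agree there.\<close>

definition regular_point :: "nat \<Rightarrow> (nat \<Rightarrow> real) \<Rightarrow> (nat \<Rightarrow> real) \<Rightarrow> surface_point \<Rightarrow> bool" where
  "regular_point q a0 b0 P \<longleftrightarrow> poly (phi a0 b0 q) (base P) \<noteq> 0"

definition m_plus :: "nat \<Rightarrow> (nat \<Rightarrow> real) \<Rightarrow> (nat \<Rightarrow> real) \<Rightarrow> surface_point \<Rightarrow> complex" where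
  "m_plus q a0 b0 P =
     (poly (anti_Delta q a0 b0) (base P) + \<i> * Omega P) / poly (phi a0 b0 q) (base P)"

definition m_minus :: "nat \<Rightarrow> (nat \<Rightarrow> real) \<Rightarrow> (nat \<Rightarrow> real) \<Rightarrow> surface_point \<Rightarrow> complex" where
  "m_minus q a0 b0 P =
     (poly (anti_Delta q a0 b0) (base P) - \<i> * Omega P) / poly (phi a0 b0 q) (base P)"

section \<open>Finite-rank perturbations and Jost functions\<close>

text \<open>A vector of \<open>\<real>\<^sup>2\<^sup>p\<close> is given by two sequences \<open>u, v\<close> of which only the entries \<open>1, \<dots>, p\<close>
  are used.\<close>

definition perturbed :: "nat \<Rightarrow> (nat \<Rightarrow> real) \<Rightarrow> (nat \<Rightarrow> real) \<Rightarrow> nat \<Rightarrow> real" where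
  "perturbed p c0 w n = (if n \<in> {1..p} then c0 n + w n else c0 n)"

definition perturbation_class ::
    "nat \<Rightarrow> (nat \<Rightarrow> real) \<Rightarrow> nat \<Rightarrow> ((nat \<Rightarrow> real) \<times> (nat \<Rightarrow> real)) set" where
  "perturbation_class p a0 \<nu> =
     {(u, v). (\<forall>n\<in>{1..p}. a0 n + u n > 0) \<and>
        (\<nu> = 2 * p \<and> u p \<noteq> 0 \<or> \<nu> = 2 * p - 1 \<and> u p = 0 \<and> v p \<noteq> 0)}"

text \<open>The solution that equals \<open>y n\<close> for \<open>n > p\<close>, obtained by running the recurrence at
  index \<open>n + 1\<close> backwards.\<close>

function backward_solution ::
    "(nat \<Rightarrow> real) \<Rightarrow> (nat \<Rightarrow> real) \<Rightarrow> nat \<Rightarrow> (nat \<Rightarrow> 'a::real_field poly) \<Rightarrow> nat \<Rightarrow> 'a poly" where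
  "backward_solution a b p y n =
     (if p < n then y n
      else smult (of_real (1 / a n))
        ([:- of_real (b (n + 1)), 1:] * backward_solution a b p y (n + 1)
         - smult (of_real (a (n + 1))) (backward_solution a b p y (n + 2))))"
  by pat_completeness auto
termination by (relation "Wellfounded.measure (\<lambda>(a, b, p, y, n). Suc p - n)") auto

declare backward_solution.simps [simp del]

definition theta_plus ::
    "(nat \<Rightarrow> real) \<Rightarrow> (nat \<Rightarrow> real) \<Rightarrow> nat \<Rightarrow> (nat \<Rightarrow> real) \<Rightarrow> (nat \<Rightarrow> real) \<Rightarrow> nat \<Rightarrow> 'a::real_field poly" where
  "theta_plus a0 b0 p u v =
     backward_solution (perturbed p a0 u) (perturbed p b0 v) p (theta a0 b0)"

definition phi_plus ::
    "(nat \<Rightarrow> real) \<Rightarrow> (nat \<Rightarrow> real) \<Rightarrow> nat \<Rightarrow> (nat \<Rightarrow> real) \<Rightarrow> (nat \<Rightarrow> real) \<Rightarrow> nat \<Rightarrow> 'a::real_field poly" where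
  "phi_plus a0 b0 p u v =
     backward_solution (perturbed p a0 u) (perturbed p b0 v) p (phi a0 b0)"

definition jost_plus :: "nat \<Rightarrow> (nat \<Rightarrow> real) \<Rightarrow> (nat \<Rightarrow> real) \<Rightarrow> nat \<Rightarrow> (nat \<Rightarrow> real) \<Rightarrow> (nat \<Rightarrow> real)
    \<Rightarrow> nat \<Rightarrow> surface_point \<Rightarrow> complex" where
  "jost_plus q a0 b0 p u v n P =
     poly (theta_plus a0 b0 p u v n) (base P) + m_plus q a0 b0 P * poly (phi_plus a0 b0 p u v n) (base P)"

definition jost_minus :: "nat \<Rightarrow> (nat \<Rightarrow> real) \<Rightarrow> (nat \<Rightarrow> real) \<Rightarrow> nat \<Rightarrow> (nat \<Rightarrow> real) \<Rightarrow> (nat \<Rightarrow> real)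
    \<Rightarrow> nat \<Rightarrow> surface_point \<Rightarrow> complex" where
  "jost_minus q a0 b0 p u v n P =
     poly (theta_plus a0 b0 p u v n) (base P) + m_minus q a0 b0 P * poly (phi_plus a0 b0 p u v n) (base P)"

definition is_F_polynomial :: "nat \<Rightarrow> (nat \<Rightarrow> real) \<Rightarrow> (nat \<Rightarrow> real) \<Rightarrow> nat \<Rightarrow> (nat \<Rightarrow> real) \<Rightarrow> (nat \<Rightarrow> real)
    \<Rightarrow> complex poly \<Rightarrow> bool" where
  "is_F_polynomial q a0 b0 p u v F \<longleftrightarrow>
     (\<forall>P\<in>first_sheet q a0 b0. regular_point q a0 b0 P \<longrightarrow>
        poly F (base P) =
          poly (phi a0 b0 q) (base P) * jost_plus q a0 b0 p u v 0 P * jost_minus q a0 b0 p u v 0 P)"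

definition F_polynomial :: "nat \<Rightarrow> (nat \<Rightarrow> real) \<Rightarrow> (nat \<Rightarrow> real) \<Rightarrow> nat \<Rightarrow> (nat \<Rightarrow> real) \<Rightarrow> (nat \<Rightarrow> real)
    \<Rightarrow> complex poly" where
  "F_polynomial q a0 b0 p u v = (THE F. is_F_polynomial q a0 b0 p u v F)"

section \<open>Well-definedness\<close>

lemma backward_solution_beyond: "p < n \<Longrightarrow> backward_solution a b p y n = y n"
  by (simp add: backward_solution.simps)

lemma jacobi_solution_backward:
  assumes a: "\<And>n. a n \<noteq> 0" and y: "jacobi_solution a0 b0 y"
    and eq: "\<And>n. n > p \<Longrightarrow> a n = a0 n" "\<And>n. n > p \<Longrightarrow> b n = b0 n"
  shows "jacobi_solution a b (backward_solution a b p y)"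
  unfolding jacobi_solution_def
proof (intro allI impI)
  fix n :: nat
  assume n: "n \<ge> 1"
  let ?g = "backward_solution a b p y"
  show "smult (of_real (a (n - 1))) (?g (n - 1)) + smult (of_real (a n)) (?g (n + 1))
      + smult (of_real (b n)) (?g n) = [:0, 1:] * ?g n"
  proof (cases "p < n - 1")
    case True
    then show ?thesis
      using n y eq[of n] eq(1)[of "n - 1"]
      by (simp add: jacobi_solution_def backward_solution_beyond)
  next
    case False
    then have "?g (n - 1) = smult (of_real (1 / a (n - 1)))
        ([:- of_real (b n), 1:] * ?g n - smult (of_real (a n)) (?g (n + 1)))"
      using n by (subst backward_solution.simps) simp
    then show ?thesis
      using a[of "n - 1"] by (simp flip: of_real_mult)
  qed
qed

lemma phi_degree:
  assumes "\<And>n. a n > 0"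
  shows "degree (phi a b (Suc n) :: 'a::real_field poly) \<le> n
         \<and> coeff (phi a b (Suc n) :: 'a poly) n \<noteq> 0"
proof (induction n rule: less_induct)
  case (less n)
  show ?case
  proof (cases n)
    case 0
    then show ?thesis by (simp add: phi_def)
  next
    case (Suc m)
    let ?f = "phi a b :: nat \<Rightarrow> 'a poly"
    have rec: "?f (Suc n) = smult (of_real (1 / a n))
        ([:- of_real (b n), 1:] * ?f n - smult (of_real (a m)) (?f m))"
      by (simp add: Suc phi_def)
    have d1: "degree (?f n) \<le> m" and c1: "coeff (?f n) m \<noteq> 0"
      using less[of m] Suc by auto
    have d2: "degree (?f m) \<le> m"
    proof (cases m)
      case 0
      then show ?thesis by (simp add: phi_def)
    next
      case (Suc k)
      then show ?thesis using less[of k] \<open>n = Suc m\<close> by auto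
    qed
    have "degree ([:- of_real (b n), 1:] * ?f n) \<le> n"
      by (rule order_trans[OF degree_mult_le]) (use d1 Suc in simp)
    moreover have "degree (smult (of_real (a m)) (?f m)) \<le> n"
      using d2 Suc by (intro order_trans[OF degree_smult_le]) simp
    ultimately have "degree (?f (Suc n)) \<le> n"
      unfolding rec by (rule order_trans[OF degree_smult_le degree_diff_le])
    moreover have "coeff (?f n) n = 0" "coeff (?f m) n = 0"
      using d1 d2 Suc by (auto intro!: coeff_eq_0)
    then have "coeff (?f (Suc n)) n = of_real (1 / a n) * coeff (?f n) m"
      unfolding rec using Suc by (simp add: coeff_pCons)
    then have "coeff (?f (Suc n)) n \<noteq> 0"
      using c1 assms[of n] by simp
    ultimately show ?thesis by simp
  qed
qed

lemma theta_degree: "degree (theta a b n :: 'a::real_field poly) \<le> n - 1"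
proof (induction n rule: less_induct)
  case (less n)
  let ?f = "theta a b :: nat \<Rightarrow> 'a poly"
  consider "n = 0" | "n = 1" | "n = 2" | m where "n = Suc (Suc (Suc m))"
    by (metis One_nat_def numeral_2_eq_2 not0_implies_Suc)
  then show ?case
  proof cases
    case 3
    then show ?thesis by (simp add: theta_def numeral_2_eq_2)
  next
    case (4 m)
    have d1: "degree (?f (Suc (Suc m))) \<le> Suc m" and d2: "degree (?f (Suc m)) \<le> m"
      using less[of "Suc (Suc m)"] less[of "Suc m"] 4 by auto
    have rec: "?f n = smult (of_real (1 / a (Suc (Suc m))))
        ([:- of_real (b (Suc (Suc m))), 1:] * ?f (Suc (Suc m)) - smult (of_real (a (Suc m))) (?f (Suc m)))"
      by (simp add: 4 theta_def)
    have "degree ([:- of_real (b (Suc (Suc m))), 1:] * ?f (Suc (Suc m))) \<le> n - 1"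
      by (rule order_trans[OF degree_mult_le]) (use d1 4 in simp)
    moreover have "degree (smult (of_real (a (Suc m))) (?f (Suc m))) \<le> n - 1"
      using d2 4 by (intro order_trans[OF degree_smult_le]) simp
    ultimately show ?thesis
      unfolding rec by (rule order_trans[OF degree_smult_le degree_diff_le])
  qed (simp_all add: theta_def)
qed

lemma Delta_degree:
  assumes "periodic_background q a0 b0" "q \<ge> 1"
  shows "degree (Delta q a0 b0 :: 'a::real_field poly) > 0"
proof -
  have "coeff (theta a0 b0 q :: 'a poly) q = 0"
    using theta_degree[of a0 b0 q, where 'a = 'a] assms(2) by (intro coeff_eq_0) simp
  moreover have "coeff (phi a0 b0 (q + 1) :: 'a poly) q \<noteq> 0"
    using phi_degree[of a0 b0 q, where 'a = 'a] assms(1) by (simp add: periodic_background_def)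
  ultimately have "coeff (Delta q a0 b0 :: 'a poly) q \<noteq> 0"
    by (simp add: Delta_def)
  then have "q \<le> degree (Delta q a0 b0 :: 'a poly)"
    by (rule le_degree)
  then show ?thesis using assms(2) by simp
qed

lemma phi_q_nonzero:
  assumes "periodic_background q a0 b0" "q \<ge> 1"
  shows "(phi a0 b0 q :: 'a::real_field poly) \<noteq> 0"
  using phi_degree[of a0 b0 "q - 1", where 'a = 'a] assms by (auto simp: periodic_background_def)

lemma wronskian:
  assumes "\<And>n. a n \<noteq> 0"
  shows "smult (of_real (a n)) (theta a b n * phi a b (Suc n) - theta a b (Suc n) * phi a b n)
           = [:of_real (a 0):: 'a::real_field:]"
proof (induction n)
  case 0
  then show ?case by (simp add: theta_def phi_def)
next
  case (Suc n)
  have expand: "smult (of_real (a (Suc n))) (y (Suc (Suc n)))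
      = [:- of_real (b (Suc n)), 1:] * y (Suc n) - smult (of_real (a n)) (y n)"
    if "jacobi_solution a b y" for y :: "nat \<Rightarrow> 'a poly"
    using that[unfolded jacobi_solution_def, rule_format, of "Suc n"]
    by (simp add: algebra_simps) 
  have t: "jacobi_solution a b (theta a b :: nat \<Rightarrow> 'a poly)"
    and p: "jacobi_solution a b (phi a b :: nat \<Rightarrow> 'a poly)"
    unfolding theta_def phi_def by (intro jacobi_solution_forward assms)+
  let ?t = "theta a b :: nat \<Rightarrow> 'a poly" and ?p = "phi a b :: nat \<Rightarrow> 'a poly"
  have "smult (of_real (a (Suc n))) (?t (Suc n) * ?p (Suc (Suc n)) - ?t (Suc (Suc n)) * ?p (Suc n))
      = ?t (Suc n) * smult (of_real (a (Suc n))) (?p (Suc (Suc n)))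
        - smult (of_real (a (Suc n))) (?t (Suc (Suc n))) * ?p (Suc n)"
    by (simp add: smult_diff_right)
  also have "\<dots> = ?t (Suc n) * ([:- of_real (b (Suc n)), 1:] * ?p (Suc n) - smult (of_real (a n)) (?p n))
        - ([:- of_real (b (Suc n)), 1:] * ?t (Suc n) - smult (of_real (a n)) (?t n)) * ?p (Suc n)"
    by (simp only: expand[OF t] expand[OF p])
  also have "\<dots> = smult (of_real (a n)) (?t n * ?p (Suc n) - ?t (Suc n) * ?p n)"
    by (simp add: algebra_simps smult_diff_right)
  finally show ?case using Suc by simp
qed

lemma F_polynomial_unique:
  assumes "periodic_background q a0 b0" "q \<ge> 1"
    and "is_F_polynomial q a0 b0 p u v F" "is_F_polynomial q a0 b0 p u v G"
  shows "F = G"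
proof (rule ccontr)
  assume "F \<noteq> G"
  define D where "D = (F - G) * phi a0 b0 q"
  have "D \<noteq> 0"
    using \<open>F \<noteq> G\<close> phi_q_nonzero[OF assms(1,2)] by (simp add: D_def)
  then have fin: "finite {z. poly D z = 0}"
    by (rule poly_roots_finite)
  have ray: "filterlim (\<lambda>y. \<i> * complex_of_real y) at_infinity at_top"
    unfolding filterlim_at_infinity_conv_norm_at_top
    by (simp add: norm_mult filterlim_abs_real)
  have "filterlim (\<lambda>y. poly (Delta q a0 b0) (\<i> * complex_of_real y)) at_infinity at_top"
    by (rule filterlim_compose[OF filterlim_poly_at_infinity[OF Delta_degree[OF assms(1,2)]] ray])
  then have "eventually (\<lambda>y. cmod (poly (Delta q a0 b0) (\<i> * complex_of_real y)) > 1) at_top"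
    unfolding filterlim_at_infinity_conv_norm_at_top filterlim_at_top_dense by blast
  moreover have "eventually (\<lambda>y. y > (0::real)) at_top"
    by (rule eventually_gt_at_top)
  ultimately have "eventually (\<lambda>y. cmod (poly (Delta q a0 b0) (\<i> * complex_of_real y)) > 1 \<and> y > 0) at_top"
    by (rule eventually_conj)
  then obtain N where N: "\<And>y. y \<ge> N \<Longrightarrow> cmod (poly (Delta q a0 b0) (\<i> * complex_of_real y)) > 1 \<and> y > 0"
    by (auto simp: eventually_at_top_linorder)
  have "infinite ((\<lambda>y. \<i> * complex_of_real y) ` {N..})"
    by (subst finite_image_iff) (auto simp: inj_on_def infinite_Ici)
  then obtain y where y: "y \<ge> N" and nz: "poly D (\<i> * complex_of_real y) \<noteq> 0"
    using fin by (metis (mono_tags, lifting) atLeast_iff finite_subset image_subsetI mem_Collect_eq)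
  define z where "z = \<i> * complex_of_real y"
  define d where "d = poly (Delta q a0 b0) z"
  have d: "cmod d > 1" and y0: "y > 0" using N[OF y] by (auto simp: d_def z_def)
  obtain w where w: "w\<^sup>2 = 1 - d\<^sup>2" and small: "cmod (d + \<i> * w) < 1"
  proof -
    define w where "w = csqrt (1 - d\<^sup>2)"
    have w2: "w\<^sup>2 = 1 - d\<^sup>2" by (simp add: w_def)
    then have prod: "(d + \<i> * w) * (d + \<i> * (- w)) = 1"
      by (simp add: algebra_simps power2_eq_square)
    then have pm: "cmod (d + \<i> * w) * cmod (d + \<i> * (- w)) = 1"
      by (metis norm_mult norm_one)
    show thesis
    proof (cases "cmod (d + \<i> * w) < 1 \<or> cmod (d + \<i> * (- w)) < 1")
      case True
      then show thesis using that[of w] that[of "- w"] w2 by auto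
    next
      case False
      then have ge: "cmod (d + \<i> * w) \<ge> 1" "cmod (d + \<i> * (- w)) \<ge> 1" by auto
      then have "cmod (d + \<i> * w) = 1" "cmod (d + \<i> * (- w)) = 1"
        using pm mult_left_mono[OF ge(2), of "cmod (d + \<i> * w)"]
          mult_right_mono[OF ge(1), of "cmod (d + \<i> * (- w))"] by auto
      moreover have "2 * d = (d + \<i> * w) + (d + \<i> * (- w))" by simp
      then have "2 * cmod d \<le> cmod (d + \<i> * w) + cmod (d + \<i> * (- w))"
        by (metis norm_mult norm_numeral norm_triangle_ineq)
      ultimately show thesis using d by simp
    qed
  qed
  have "z \<notin> complex_of_real ` ac_spectrum q a0 b0"
    using y0 by (auto simp: z_def complex_eq_iff)
  then have "(z, w) \<in> first_sheet q a0 b0"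
    using w small by (simp add: first_sheet_def Lambda_surface_def d_def)
  moreover have "regular_point q a0 b0 (z, w)"
    using nz by (simp add: regular_point_def D_def z_def)
  ultimately have "poly F z = poly G z"
    using assms(3,4) by (fastforce simp: is_F_polynomial_def)
  then show False using nz by (simp add: D_def z_def)
qed

lemma F_polynomial_exists:
  assumes bg: "periodic_background q a0 b0"
  shows "\<exists>F. is_F_polynomial q a0 b0 p u v F"
proof -
  let ?T = "theta_plus a0 b0 p u v 0 :: complex poly"
  let ?P = "phi_plus a0 b0 p u v 0 :: complex poly"
  let ?A = "anti_Delta q a0 b0 :: complex poly" and ?D = "Delta q a0 b0 :: complex poly"
  let ?f = "phi a0 b0 q :: complex poly" and ?t = "theta a0 b0 (Suc q) :: complex poly"
  have a: "\<And>n. a0 n > 0" and aq: "a0 q = a0 0"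
    using bg by (auto simp: periodic_background_def dest: spec[of _ 0])
  have "smult (of_real (a0 0)) (theta a0 b0 q * phi a0 b0 (Suc q) - ?t * ?f) = [:of_real (a0 0):]"
    using wronskian[of a0 q b0, where 'a = complex] a aq by (metis less_irrefl)
  also have "\<dots> = smult (of_real (a0 0)) 1" by simp
  finally have W: "theta a0 b0 q * phi a0 b0 (Suc q) - ?t * ?f = 1"
    using a[of 0] by (metis less_irrefl of_real_eq_0_iff smult_cancel)
  let ?F = "?f * ?T\<^sup>2 + 2 * ?A * ?T * ?P - ?t * ?P\<^sup>2"
  have "poly ?F (base Q) =
      poly ?f (base Q) * jost_plus q a0 b0 p u v 0 Q * jost_minus q a0 b0 p u v 0 Q"
    if Q: "Q \<in> first_sheet q a0 b0" "regular_point q a0 b0 Q" for Q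
  proof -
    define z w where "z = base Q" and "w = Omega Q"
    have f0: "poly ?f z \<noteq> 0" using Q by (simp add: regular_point_def z_def)
    have w2: "w\<^sup>2 = 1 - (poly ?D z)\<^sup>2"
      using Q by (simp add: first_sheet_def Lambda_surface_def z_def w_def)
    have AD: "(poly ?D z)\<^sup>2 - (poly ?A z)\<^sup>2 = poly (theta a0 b0 q * phi a0 b0 (Suc q)) z"
      by (simp add: Delta_def anti_Delta_def power2_eq_square field_simps)
    have "poly (theta a0 b0 q * phi a0 b0 (Suc q)) z - poly ?t z * poly ?f z = 1"
      using arg_cong[OF W, of "\<lambda>r. poly r z"] by simp
    then have key: "(poly ?A z)\<^sup>2 + w\<^sup>2 = - poly ?t z * poly ?f z"
      using AD w2 by algebra
    have "poly ?f z * jost_plus q a0 b0 p u v 0 Q * jost_minus q a0 b0 p u v 0 Q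
        = poly ?f z * (poly ?T z + (poly ?A z + \<i> * w) / poly ?f z * poly ?P z)
            * (poly ?T z + (poly ?A z - \<i> * w) / poly ?f z * poly ?P z)"
      by (simp add: jost_plus_def jost_minus_def m_plus_def m_minus_def z_def w_def)
    also have "\<dots> = poly ?f z * (poly ?T z)\<^sup>2 + 2 * poly ?A z * poly ?T z * poly ?P z
        + ((poly ?A z)\<^sup>2 + w\<^sup>2) / poly ?f z * (poly ?P z)\<^sup>2"
      using f0 by (simp add: field_simps power2_eq_square)
    also have "\<dots> = poly ?F z"
      unfolding key using f0 by (simp add: power2_eq_square)
    finally show ?thesis by (simp add: z_def)
  qed
  then show ?thesis unfolding is_F_polynomial_def by blast
qed

lemma F_polynomial:
  assumes "periodic_background q a0 b0" "q \<ge> 1"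
  shows "is_F_polynomial q a0 b0 p u v (F_polynomial q a0 b0 p u v)"
proof -
  have "\<exists>!F. is_F_polynomial q a0 b0 p u v F"
    using F_polynomial_exists F_polynomial_unique assms by blast
  then show ?thesis unfolding F_polynomial_def by (rule theI')
qed

end

theory Submission
  imports Defs
begin

text \<open>Write \<open>T\<close> and \<open>P\<close> for \<open>\<theta>\<^sub>0\<^sup>+\<close> and \<open>\<phi>\<^sub>0\<^sup>+\<close>, and \<open>\<phi>\<close> for \<open>(\<phi>\<^sub>q\<^sub>+\<^sub>1 - \<theta>\<^sub>q) / 2\<close>. Since
  \<open>f\<^sub>0\<^sup>+ = T + m\<^sub>+ P\<close> and \<open>m\<^sub>+\<close> belongs to the background, the Jost function is known as soon as \<open>T\<close>
  is. Multiplying out \<open>F = \<phi>\<^sub>q f\<^sub>0\<^sup>+ f\<^sub>0\<^sup>-\<close> and completing the square gives the polynomial identity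
  \<open>\<phi>\<^sub>q F = (\<phi>\<^sub>q T + \<phi> P)\<^sup>2 + (1 - \<Delta>\<^sup>2) P\<^sup>2\<close> (lemma \<open>phi_q_times_F\<close>), so that \<open>F\<close> and \<open>P\<close> determine
  \<open>\<phi>\<^sub>q T + \<phi> P\<close> up to its sign.

  The sign is fixed by the behaviour at infinity. Each backward step of the recurrence raises the
  degree by one once the outermost nonzero entry of the perturbation has made itself felt, and
  \<open>\<phi>\<^sup>+\<close> starts that process with at least the degree of \<open>\<theta>\<^sup>+\<close>; hence \<open>deg T \<le> deg P\<close> (lemma
  \<open>phi_plus_dominates_theta_plus\<close>). As \<open>deg \<phi>\<^sub>q < q = deg \<phi>\<close>, the leading coefficient of
  \<open>\<phi>\<^sub>q T + \<phi> P\<close> is that of \<open>\<phi> P\<close>, which is given, and so the opposite sign is excluded (lemma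
  \<open>summand_determined_by_square\<close>).\<close>

section \<open>The polynomial F as a completed square\<close>

text \<open>The monodromy matrix of the periodic recurrence has determinant \<open>\<theta>\<^sub>q \<phi>\<^sub>q\<^sub>+\<^sub>1 - \<theta>\<^sub>q\<^sub>+\<^sub>1 \<phi>\<^sub>q = 1\<close>
  because \<open>a\<^sub>q = a\<^sub>0\<close>. Half the sum and half the difference of its diagonal entries are \<open>\<Delta>\<close> and \<open>\<phi>\<close>,
  so their squares differ by the product of these entries.\<close>

lemma anti_Delta_square:
  assumes "periodic_background q a0 b0"
  shows "(anti_Delta q a0 b0)\<^sup>2 + 1 - (Delta q a0 b0)\<^sup>2
           = - (theta a0 b0 (Suc q) * phi a0 b0 q :: 'a::real_field poly)"
proof -
  have a: "a0 n > 0" for n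
    using assms by (simp add: periodic_background_def)
  have aq: "a0 q = a0 0"
    using assms by (auto simp: periodic_background_def dest: spec[of _ 0])
  have "smult (of_real (a0 0)) (theta a0 b0 q * phi a0 b0 (Suc q) - theta a0 b0 (Suc q) * phi a0 b0 q)
          = [:of_real (a0 0) :: 'a:]"
    using wronskian[of a0 q b0, where 'a = 'a] a aq by (metis less_irrefl)
  also have "\<dots> = smult (of_real (a0 0)) 1" by simp
  finally have W: "theta a0 b0 q * phi a0 b0 (Suc q) - theta a0 b0 (Suc q) * phi a0 b0 q = (1 :: 'a poly)"
    using a[of 0] by (metis less_irrefl of_real_eq_0_iff smult_cancel)
  have half: "(smult (1 / 2) (x - y))\<^sup>2 - (smult (1 / 2) (x + y))\<^sup>2 = - (y * x)" for x y :: "'a poly"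
  proof -
    define h k where "h = smult (1 / 2) x" and "k = smult (1 / 2) y"
    have "x = h + h" "y = k + k"
      by (simp_all add: h_def k_def flip: smult_add_left)
    moreover have "smult (1 / 2) (x - y) = h - k" "smult (1 / 2) (x + y) = h + k"
      by (simp_all add: h_def k_def smult_diff_right smult_add_right)
    ultimately show ?thesis by algebra
  qed
  have "(anti_Delta q a0 b0)\<^sup>2 - (Delta q a0 b0)\<^sup>2 = - (theta a0 b0 q * phi a0 b0 (Suc q) :: 'a poly)"
    unfolding anti_Delta_def Delta_def by (simp only: half Suc_eq_plus1)
  then show ?thesis using W by (simp add: algebra_simps)
qed

text \<open>On the surface \<open>\<phi>\<^sub>q f\<^sub>0\<^sup>\<plusminus> = (\<phi>\<^sub>q T + \<phi> P) \<plusminus> i\<Omega> P\<close>, so \<open>\<phi>\<^sub>q F\<close> is a sum of two squares with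
  \<open>\<Omega>\<^sup>2 = 1 - \<Delta>\<^sup>2\<close>. That \<open>\<phi>\<^sub>q\<close> divides this sum in the polynomial ring is the content of
  \<open>anti_Delta_square\<close>.\<close>

lemma phi_q_times_F:
  assumes bg: "periodic_background q a0 b0" and "q \<ge> 1"
  shows "phi a0 b0 q * F_polynomial q a0 b0 p u v
           = (phi a0 b0 q * theta_plus a0 b0 p u v 0 + anti_Delta q a0 b0 * phi_plus a0 b0 p u v 0)\<^sup>2
             + (1 - (Delta q a0 b0)\<^sup>2) * (phi_plus a0 b0 p u v 0)\<^sup>2"
proof -
  let ?f = "phi a0 b0 q :: complex poly" and ?t = "theta a0 b0 (Suc q) :: complex poly"
  let ?A = "anti_Delta q a0 b0 :: complex poly" and ?D = "Delta q a0 b0 :: complex poly"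
  let ?T = "theta_plus a0 b0 p u v 0 :: complex poly"
  let ?P = "phi_plus a0 b0 p u v 0 :: complex poly"
  define G where "G = ?f * ?T\<^sup>2 + 2 * ?A * ?T * ?P - ?t * ?P\<^sup>2"
  have sq: "?A\<^sup>2 + 1 - ?D\<^sup>2 = - (?t * ?f)"
    by (rule anti_Delta_square[OF bg])
  have G: "?f * G = (?f * ?T + ?A * ?P)\<^sup>2 + (1 - ?D\<^sup>2) * ?P\<^sup>2"
    unfolding G_def using sq by algebra
  have "is_F_polynomial q a0 b0 p u v G"
    unfolding is_F_polynomial_def
  proof (intro ballI impI)
    fix Q assume Q: "Q \<in> first_sheet q a0 b0" "regular_point q a0 b0 Q"
    define z w where "z = base Q" and "w = Omega Q"
    have f0: "poly ?f z \<noteq> 0"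
      using Q by (simp add: regular_point_def z_def)
    have w2: "w\<^sup>2 = 1 - (poly ?D z)\<^sup>2"
      using Q by (simp add: first_sheet_def Lambda_surface_def z_def w_def)
    have "poly ?f z * (poly ?f z * jost_plus q a0 b0 p u v 0 Q * jost_minus q a0 b0 p u v 0 Q)
        = (poly ?f z * poly ?T z + poly ?A z * poly ?P z + \<i> * w * poly ?P z)
          * (poly ?f z * poly ?T z + poly ?A z * poly ?P z - \<i> * w * poly ?P z)"
      using f0 by (simp add: jost_plus_def jost_minus_def m_plus_def m_minus_def field_simps
                        flip: z_def w_def)
    also have "\<dots> = (poly ?f z * poly ?T z + poly ?A z * poly ?P z)\<^sup>2 + w\<^sup>2 * (poly ?P z)\<^sup>2"
      by (simp add: power2_eq_square algebra_simps)
    also have "\<dots> = poly ?f z * poly G z"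
      unfolding w2 using arg_cong[OF G, of "\<lambda>r. poly r z"] by simp
    finally show "poly G (base Q) =
        poly ?f (base Q) * jost_plus q a0 b0 p u v 0 Q * jost_minus q a0 b0 p u v 0 Q"
      using f0 by (simp add: z_def)
  qed
  then have "F_polynomial q a0 b0 p u v = G"
    using F_polynomial_unique F_polynomial assms by blast
  then show ?thesis using G by simp
qed

section \<open>Degrees of the backward solutions\<close>

lemma degree_backward_step_le:
  fixes y1 y2 :: "'a::real_field poly"
  assumes "degree y1 \<le> d" "degree y2 \<le> d"
  shows "degree (smult c ([:- b, 1:] * y1 - smult a y2)) \<le> Suc d"
proof -
  have "degree ([:- b, 1:] * y1) \<le> Suc d"
    by (rule order_trans[OF degree_mult_le]) (use assms in simp)
  moreover have "degree (smult a y2) \<le> Suc d"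
    using assms by (intro order_trans[OF degree_smult_le]) simp
  ultimately show ?thesis
    by (rule order_trans[OF degree_smult_le degree_diff_le])
qed

lemma degree_backward_step:
  fixes y1 y2 :: "'a::real_field poly"
  assumes "y1 \<noteq> 0" "degree y2 \<le> degree y1" "c \<noteq> 0"
  shows "degree (smult c ([:- b, 1:] * y1 - smult a y2)) = Suc (degree y1)"
proof (rule antisym)
  have "coeff y1 (Suc (degree y1)) = 0" "coeff y2 (Suc (degree y1)) = 0"
    using assms(2) by (auto intro!: coeff_eq_0)
  then have "coeff (smult c ([:- b, 1:] * y1 - smult a y2)) (Suc (degree y1)) = c * lead_coeff y1"
    by (simp add: coeff_pCons)
  also have "\<dots> \<noteq> 0"
    using assms by simp
  finally show "Suc (degree y1) \<le> degree (smult c ([:- b, 1:] * y1 - smult a y2))"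
    by (rule le_degree)
qed (intro degree_backward_step_le order_refl assms(2))

text \<open>The equation at the index \<open>p + 1\<close> contains the perturbation only in the weight \<open>a\<^sub>p\<close>, as the factor
  of \<open>y\<^sub>p\<close>.\<close>

lemma backward_solution_at_p:
  fixes y :: "nat \<Rightarrow> 'a::real_field poly"
  assumes "jacobi_solution a0 b0 y" "p \<ge> 1"
  shows "backward_solution (perturbed p a0 u) (perturbed p b0 v) p y p
           = smult (of_real (a0 p / (a0 p + u p))) (y p)"
proof -
  have "[:- of_real (b0 (Suc p)), 1:] * y (Suc p) - smult (of_real (a0 (Suc p))) (y (Suc (Suc p)))
          = smult (of_real (a0 p)) (y p)"
    using assms(1)[unfolded jacobi_solution_def, rule_format, of "Suc p"]
    by (simp add: algebra_simps)
  then show ?thesis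
    using assms(2)
    by (subst backward_solution.simps) (simp add: backward_solution_beyond perturbed_def)
qed

text \<open>Subtracting the background equation at the index \<open>p\<close> shows where the perturbation first changes
  more than a scalar factor: at \<open>p - 1\<close> the entry \<open>u\<^sub>p\<close> multiplies \<open>y\<^sub>p\<^sub>+\<^sub>1\<close> and \<open>v\<^sub>p\<close> multiplies \<open>y\<^sub>p\<close>. For \<open>y = \<phi>\<close>
  the first of these two terms has the highest degree if \<open>u\<^sub>p\<close> does not vanish, and the second one
  if \<open>u\<^sub>p = 0\<close> and \<open>v\<^sub>p\<close> does not vanish.\<close>

lemma backward_solution_below_p:
  fixes y :: "nat \<Rightarrow> 'a::real_field poly"
  assumes p: "p = Suc m" and sol: "jacobi_solution a0 b0 y" and nz: "\<And>n. perturbed p a0 u n \<noteq> 0"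
  shows "smult (of_real (perturbed p a0 u p * perturbed p a0 u m))
           (backward_solution (perturbed p a0 u) (perturbed p b0 v) p y m)
         = smult (of_real (a0 p)) (smult (of_real (a0 m)) (y m) - smult (of_real (v p)) (y p))
           - smult (of_real (u p * (2 * a0 p + u p))) (y (Suc p))"
proof -
  let ?g = "backward_solution (perturbed p a0 u) (perturbed p b0 v) p y"
  define r s where "r = a0 p + u p" and "s = perturbed p a0 u m"
  have r: "perturbed p a0 u p = r"
    by (simp add: perturbed_def p r_def)
  have rs: "r \<noteq> 0" "s \<noteq> 0"
    using nz[of p] nz[of m] r by (simp_all add: s_def)
  have gp: "?g p = smult (of_real (a0 p / r)) (y p)"
    unfolding r_def by (rule backward_solution_at_p[OF sol]) (simp add: p)
  have "?g m = smult (of_real (1 / s)) ([:- of_real (b0 p + v p), 1:] * ?g p - smult (of_real r) (y (Suc p)))"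
    by (subst backward_solution.simps)
       (simp add: backward_solution_beyond perturbed_def p r_def s_def)
  also have "smult (of_real (r * s)) \<dots>
      = smult (of_real (a0 p)) ([:- of_real (b0 p + v p), 1:] * y p) - smult (of_real (r\<^sup>2)) (y (Suc p))"
    unfolding gp using rs by (simp add: smult_diff_right power2_eq_square)
  also have "[:- of_real (b0 p + v p), 1:] * y p = [:0, 1:] * y p - smult (of_real (b0 p + v p)) (y p)"
    by (simp add: algebra_simps flip: smult_add_left)
  also have "[:0, 1:] * y p
      = smult (of_real (a0 m)) (y m) + smult (of_real (a0 p)) (y (Suc p)) + smult (of_real (b0 p)) (y p)"
    using sol[unfolded jacobi_solution_def, rule_format, of p] by (simp add: p)
  finally show ?thesis
    unfolding r by (simp add: poly_eq_iff r_def s_def algebra_simps power2_eq_square)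
qed

text \<open>The condition imposed on the last entry of the perturbation is what makes \<open>\<phi>\<^sup>+\<close> reach at
  \<open>p - 1\<close> a degree that neither its next entry nor \<open>\<theta>\<^sup>+\<close> exceeds.\<close>

lemma phi_plus_dominates_below_p:
  fixes p :: nat and b0 :: "nat \<Rightarrow> real"
  assumes a0: "\<And>n. a0 n > 0" and uv: "(u, v) \<in> perturbation_class p a0 \<nu>" and p: "p = Suc m"
  defines "f \<equiv> phi_plus a0 b0 p u v :: nat \<Rightarrow> 'a::real_field poly"
    and "t \<equiv> theta_plus a0 b0 p u v :: nat \<Rightarrow> 'a poly"
  shows "f m \<noteq> 0 \<and> degree (f (Suc m)) \<le> degree (f m) \<and>
         degree (t m) \<le> degree (f m) \<and> degree (t (Suc m)) \<le> degree (f m)"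
proof -
  let ?P = "phi a0 b0 :: nat \<Rightarrow> 'a poly" and ?T = "theta a0 b0 :: nat \<Rightarrow> 'a poly"
  have pos: "perturbed p a0 u n > 0" for n
    using a0 uv by (auto simp: perturbed_def perturbation_class_def)
  have cls: "u p \<noteq> 0 \<or> u p = 0 \<and> v p \<noteq> 0" and up: "a0 p + u p > 0"
    using uv by (auto simp: perturbation_class_def p)
  define c where "c = (of_real (perturbed p a0 u p * perturbed p a0 u m) :: 'a)"
  have c: "c \<noteq> 0"
    using pos[of p] pos[of m] by (simp add: c_def)
  have solP: "jacobi_solution a0 b0 ?P" and solT: "jacobi_solution a0 b0 ?T"
    unfolding phi_def theta_def using a0 by (intro jacobi_solution_forward; metis less_irrefl)+
  have nz: "perturbed p a0 u n \<noteq> 0" for n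
    using pos[of n] by simp
  note below = backward_solution_below_p[where 'a = 'a and p = p and m = m and u = u and v = v,
      OF p _ nz, folded c_def]
  have fm: "smult c (f m) = smult (of_real (a0 p)) (smult (of_real (a0 m)) (?P m) - smult (of_real (v p)) (?P p))
      - smult (of_real (u p * (2 * a0 p + u p))) (?P (Suc p))"
    unfolding f_def phi_plus_def by (rule below[OF solP])
  have tm: "smult c (t m) = smult (of_real (a0 p)) (smult (of_real (a0 m)) (?T m) - smult (of_real (v p)) (?T p))
      - smult (of_real (u p * (2 * a0 p + u p))) (?T (Suc p))"
    unfolding t_def theta_plus_def by (rule below[OF solT])
  have fp: "degree (f p) \<le> degree (?P p)"
    unfolding f_def phi_plus_def using p by (subst backward_solution_at_p[OF solP]) auto
  have tp: "degree (t p) \<le> degree (?T p)"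
    unfolding t_def theta_plus_def using p by (subst backward_solution_at_p[OF solT]) auto
  have P1: "degree (?P (Suc n)) \<le> n" "coeff (?P (Suc n)) n \<noteq> 0" for n
    using phi_degree[of a0 b0 n, where 'a = 'a] a0 by auto
  have T1: "degree (?T n) \<le> n - 1" for n
    by (rule theta_degree)
  have Pm0: "coeff (?P m) k = 0" if "k \<ge> m" for k
  proof (cases m)
    case 0
    then show ?thesis by (simp add: phi_def)
  next
    case (Suc j)
    then show ?thesis using P1(1)[of j] that by (intro coeff_eq_0) simp
  qed
  \<comment> \<open>The degree of the topmost term in the equation for \<open>f m\<close>: that of \<open>\<phi>\<^sub>p\<^sub>+\<^sub>1\<close>, or that of \<open>\<phi>\<^sub>p\<close> once
      the coefficient of \<open>\<phi>\<^sub>p\<^sub>+\<^sub>1\<close> vanishes.\<close>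
  define d where "d = (if u p = 0 then m else p)"
  have "c * coeff (f m) d \<noteq> 0"
  proof (cases "u p = 0")
    case True
    then have "c * coeff (f m) d = - of_real (a0 p * v p) * coeff (?P p) m"
      using arg_cong[OF fm, of "\<lambda>r. coeff r d"] Pm0[of m] by (simp add: d_def)
    then show ?thesis using cls True P1(2)[of m] a0[of p] p by simp
  next
    case False
    have "coeff (?P p) p = 0"
      using P1(1)[of m] p by (intro coeff_eq_0) simp
    with False have "c * coeff (f m) d = - of_real (u p * (2 * a0 p + u p)) * coeff (?P (Suc p)) p"
      using arg_cong[OF fm, of "\<lambda>r. coeff r d"] Pm0[of p] p by (simp add: d_def)
    \<comment> \<open>This is the sum of the two positive weights at \<open>p\<close>, so \<open>u\<^sub>p\<close> alone decides.\<close>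
    moreover have "2 * a0 p + u p \<noteq> 0"
      using up a0[of p] by simp
    ultimately show ?thesis using False P1(2)[of p]
      by (simp del: of_real_mult of_real_add)
  qed
  then have d: "d \<le> degree (f m)" and f0: "f m \<noteq> 0"
    by (auto intro: le_degree)
  have md: "m \<le> d"
    by (simp add: d_def p)
  have "degree (smult (of_real (u p * (2 * a0 p + u p))) (?T (Suc p))) \<le> d"
    using T1[of "Suc p"] by (cases "u p = 0") (auto simp: d_def intro: order_trans[OF degree_smult_le])
  moreover have "degree (?T m) \<le> d" "degree (?T p) \<le> d"
    using T1[of m] T1[of p] md p by auto
  ultimately have "degree (smult c (t m)) \<le> d"
    unfolding tm
    by (intro degree_diff_le) (auto intro!: degree_diff_le intro: order_trans[OF degree_smult_le])
  then have "degree (t m) \<le> d"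
    using c by simp
  moreover have "degree (f (Suc m)) \<le> d" "degree (t (Suc m)) \<le> d"
    using fp tp P1(1)[of m] T1[of p] md p by auto
  ultimately show ?thesis using d f0 by auto
qed

text \<open>Multiplication by \<open>\<lambda> - b\<^sub>n\<^sub>+\<^sub>1\<close> dominates a backward step of \<open>\<phi>\<^sup>+\<close>, whose degree therefore grows by
  exactly one each time, and that of \<open>\<theta>\<^sup>+\<close> by at most one relative to the same bound.\<close>

lemma phi_plus_dominates_theta_plus:
  assumes a0: "\<And>n. a0 n > 0" and "p \<ge> 1" and uv: "(u, v) \<in> perturbation_class p a0 \<nu>"
  shows "(phi_plus a0 b0 p u v 0 :: 'a::real_field poly) \<noteq> 0"
    and "degree (theta_plus a0 b0 p u v 0 :: 'a poly) \<le> degree (phi_plus a0 b0 p u v 0 :: 'a poly)"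
proof -
  let ?f = "phi_plus a0 b0 p u v :: nat \<Rightarrow> 'a poly" and ?t = "theta_plus a0 b0 p u v :: nat \<Rightarrow> 'a poly"
  obtain m where p: "p = Suc m"
    using \<open>p \<ge> 1\<close> by (cases p) auto
  have "perturbed p a0 u n > 0" for n
    using a0 uv by (auto simp: perturbed_def perturbation_class_def)
  then have nz: "perturbed p a0 u n \<noteq> 0" for n
    by (metis less_irrefl)
  have one_step: "backward_solution (perturbed p a0 u) b p y n =
      smult (of_real (1 / perturbed p a0 u n))
        ([:- of_real (b (Suc n)), 1:] * backward_solution (perturbed p a0 u) b p y (Suc n)
         - smult (of_real (perturbed p a0 u (Suc n))) (backward_solution (perturbed p a0 u) b p y (Suc (Suc n))))"
    if "n < m" for n b and y :: "nat \<Rightarrow> 'a poly"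
    using that p by (subst backward_solution.simps) simp
  have "?f n \<noteq> 0 \<and> degree (?f (Suc n)) \<le> degree (?f n) \<and>
        degree (?t n) \<le> degree (?f n) \<and> degree (?t (Suc n)) \<le> degree (?f n)" if "n \<le> m" for n
    using that
  proof (induction n rule: inc_induct)
    case base
    show ?case
      by (rule phi_plus_dominates_below_p[OF a0 uv p])
  next
    case (step n)
    have "degree (?f n) = Suc (degree (?f (Suc n)))"
      using step.IH nz[of n] unfolding phi_plus_def one_step[OF step.hyps(2)]
      by (intro degree_backward_step) auto
    moreover have "degree (?t n) \<le> Suc (degree (?f (Suc n)))"
      using step.IH unfolding theta_plus_def one_step[OF step.hyps(2)]
      by (intro degree_backward_step_le) auto
    ultimately show ?case using step.IH by auto
  qed
  from this[of 0] show "?f 0 \<noteq> 0" "degree (?t 0) \<le> degree (?f 0)" by auto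
qed

section \<open>Fixing the sign of the square root\<close>

text \<open>If \<open>T\<close> and \<open>T'\<close> gave opposite values inside the square, then \<open>f (T + T') = -2 A P\<close>, whose right
  side has the larger degree.\<close>

lemma summand_determined_by_square:
  fixes f A P T T' :: "'a::{idom, ring_char_0} poly"
  assumes sq: "(f * T' + A * P)\<^sup>2 = (f * T + A * P)\<^sup>2"
    and "f \<noteq> 0" "P \<noteq> 0" and fA: "degree f < degree A"
    and T: "degree T \<le> degree P" "degree T' \<le> degree P"
  shows "T' = T"
proof -
  have A: "A \<noteq> 0" using fA by auto
  have "f * (T + T') + 2 * (A * P) \<noteq> 0"
  proof
    assume "f * (T + T') + 2 * (A * P) = 0"
    then have eq: "2 * (A * P) = - (f * (T + T'))"
      by (simp add: eq_neg_iff_add_eq_0 add.commute)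
    have "degree (2 * (A * P)) = degree A + degree P"
      using A \<open>P \<noteq> 0\<close> by (simp add: degree_mult_eq numeral_mult_conv_smult del: mult_numeral_left)
    moreover have "degree (f * (T + T')) \<le> degree f + degree P"
      using T by (intro order_trans[OF degree_mult_le] add_left_mono degree_add_le)
    ultimately show False using fA eq by simp
  qed
  moreover have "f * (T' - T) * (f * (T + T') + 2 * (A * P)) = 0"
    using sq by (simp add: power2_eq_square algebra_simps)
  ultimately show ?thesis using \<open>f \<noteq> 0\<close> by simp
qed

lemma degree_phi_q_less_anti_Delta:
  assumes "\<And>n. a0 n > 0" "q \<ge> 1"
  shows "degree (phi a0 b0 q :: 'a::real_field poly) < degree (anti_Delta q a0 b0 :: 'a poly)"
proof -
  have "coeff (theta a0 b0 q :: 'a poly) q = 0"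
    using theta_degree[of a0 b0 q, where 'a = 'a] assms(2) by (intro coeff_eq_0) simp
  moreover have "coeff (phi a0 b0 (q + 1) :: 'a poly) q \<noteq> 0"
    using phi_degree[of a0 b0 q, where 'a = 'a] assms(1) by simp
  ultimately have "coeff (anti_Delta q a0 b0 :: 'a poly) q \<noteq> 0"
    by (simp add: anti_Delta_def)
  then have "q \<le> degree (anti_Delta q a0 b0 :: 'a poly)"
    by (rule le_degree)
  moreover have "degree (phi a0 b0 q :: 'a poly) \<le> q - 1"
    using phi_degree[of a0 b0 "q - 1", where 'a = 'a] assms by simp
  ultimately show ?thesis using assms(2) by simp
qed

theorem theorem1p4:
  fixes q p \<nu> :: nat and a0 b0 u v u' v' :: "nat \<Rightarrow> real"
  assumes "q \<ge> 2" and "p \<ge> 1"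
    and "periodic_background q a0 b0"
    and "all_gaps_open q a0 b0"
    and "\<nu> \<in> {2 * p - 1, 2 * p}"
    and "(u, v) \<in> perturbation_class p a0 \<nu>"
    and "(u', v') \<in> perturbation_class p a0 \<nu>"
    and "rsquarefree (F_polynomial q a0 b0 p u v)"
    and "F_polynomial q a0 b0 p u' v' = F_polynomial q a0 b0 p u v"
    and "(phi_plus a0 b0 p u' v' 0 :: complex poly) = phi_plus a0 b0 p u v 0"
  shows "\<forall>P\<in>Lambda_surface q a0 b0. regular_point q a0 b0 P \<longrightarrow>
           jost_plus q a0 b0 p u' v' 0 P = jost_plus q a0 b0 p u v 0 P"
proof -
  have a0: "a0 n > 0" for n
    using assms(3) by (simp add: periodic_background_def)
  have q: "q \<ge> 1"
    using assms(1) by simp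
  let ?P = "phi_plus a0 b0 p u v 0 :: complex poly"
  have "(phi a0 b0 q * theta_plus a0 b0 p u' v' 0 + anti_Delta q a0 b0 * ?P)\<^sup>2
          = (phi a0 b0 q * theta_plus a0 b0 p u v 0 + anti_Delta q a0 b0 * ?P)\<^sup>2"
    using phi_q_times_F[OF assms(3) q, of p u v] phi_q_times_F[OF assms(3) q, of p u' v'] assms(9,10)
    by simp
  then have "(theta_plus a0 b0 p u' v' 0 :: complex poly) = theta_plus a0 b0 p u v 0"
  proof (rule summand_determined_by_square)
    show "(phi a0 b0 q :: complex poly) \<noteq> 0"
      by (rule phi_q_nonzero[OF assms(3) q])
    show "degree (phi a0 b0 q :: complex poly) < degree (anti_Delta q a0 b0 :: complex poly)"
      by (rule degree_phi_q_less_anti_Delta[OF a0 q])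
    show "?P \<noteq> 0" "degree (theta_plus a0 b0 p u v 0 :: complex poly) \<le> degree ?P"
      by (rule phi_plus_dominates_theta_plus[OF a0 assms(2,6)])+
    show "degree (theta_plus a0 b0 p u' v' 0 :: complex poly) \<le> degree ?P"
      unfolding assms(10)[symmetric] by (rule phi_plus_dominates_theta_plus[OF a0 assms(2,7)])
  qed
  then show ?thesis
    by (simp add: jost_plus_def assms(10))
qed

end
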